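(* There exist infinitely many bipartite RAC graphs $G$ such that, with $n$ denoting the number of vertices of $G$, $G$ has exactly $3n-9$ edges.
   Context: A (simple) graph is a RAC (right-angle-crossing) graph if it admits a straight-line drawing in the plane (vertices at distinct points, edges as straight segments not passing through other vertices) in which any two crossing edges cross at a right angle. *)

theory Defs
  imports "HOL-Analysis.Analysis"
begin

type_synonym 'a graph = "'a set \<times> 'a set set"

abbreviation verts :: "'a graph \<Rightarrow> 'a set" where
  "verts G \<equiv> fst G"

abbreviation edges :: "'a graph \<Rightarrow> 'a set set" where
  "edges G \<equiv> snd G"

definition simple_graph :: "'a graph \<Rightarrow> bool" where
  "simple_graph G \<longleftrightarrow> finite (verts G) \<and> (\<forall>e\<in>edges G. e \<subseteq> verts G \<and> card e = 2)"

definition bipartite :: "'a graph \<Rightarrow> bool" where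
  "bipartite G \<longleftrightarrow> (\<exists>A B. A \<inter> B = {} \<and> A \<union> B = verts G \<and>
     (\<forall>e\<in>edges G. \<exists>a\<in>A. \<exists>b\<in>B. e = {a, b}))"

definition isomorphic_graphs :: "'a graph \<Rightarrow> 'b graph \<Rightarrow> bool" where
  "isomorphic_graphs G H \<longleftrightarrow> (\<exists>f. bij_betw f (verts G) (verts H) \<and>
     (\<forall>u\<in>verts G. \<forall>v\<in>verts G. {u, v} \<in> edges G \<longleftrightarrow> {f u, f v} \<in> edges H))"

definition straight_line_drawing :: "'a graph \<Rightarrow> ('a \<Rightarrow> real \<times> real) \<Rightarrow> bool" where
  "straight_line_drawing G p \<longleftrightarrow> inj_on p (verts G) \<and>
     (\<forall>u v w. {u, v} \<in> edges G \<and> w \<in> verts G - {u, v} \<longrightarrow>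
        p w \<notin> closed_segment (p u) (p v))"

text \<open>Distinct edges cross if they share a point in their relative interiors. In a straight-line
  drawing of a simple graph they cannot overlap in a nondegenerate segment, since an endpoint of
  one edge would then lie on the other.\<close>

definition edges_cross :: "('a \<Rightarrow> real \<times> real) \<Rightarrow> 'a \<Rightarrow> 'a \<Rightarrow> 'a \<Rightarrow> 'a \<Rightarrow> bool" where
  "edges_cross p u v x y \<longleftrightarrow> {u, v} \<noteq> {x, y} \<and>
     open_segment (p u) (p v) \<inter> open_segment (p x) (p y) \<noteq> {}"

definition RAC_drawing :: "'a graph \<Rightarrow> ('a \<Rightarrow> real \<times> real) \<Rightarrow> bool" where
  "RAC_drawing G p \<longleftrightarrow> straight_line_drawing G p \<and>
     (\<forall>u v x y. {u, v} \<in> edges G \<and> {x, y} \<in> edges G \<and> edges_cross p u v x y \<longrightarrow>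
        orthogonal (p v - p u) (p y - p x))"

definition RAC_graph :: "'a graph \<Rightarrow> bool" where
  "RAC_graph G \<longleftrightarrow> simple_graph G \<and> (\<exists>p. RAC_drawing G p)"

end

theory Submission
  imports Defs
begin

text \<open>
  The graphs are drawn as nested hexagons whose vertices alternate between the two colours. Between
  two consecutive hexagons with corresponding vertices $v_i$ and $w_i$ run the edges $v_i w_{i+1}$
  and $v_{i+1} w_i$, which cross at a right angle and nowhere else. Each new hexagon thus brings 6
  vertices and 18 edges. In the innermost hexagon two long diagonals are perpendicular and are added
  as edges; the outermost hexagon is not convex, so that one more long diagonal can be drawn outside.
  Hence $m$ hexagons yield $n = 6m$ vertices and $6 + 2 + 18(m-1) + 1 = 3n - 9$ edges.

  All hexagons but the first and the last are homothetic with ratio 4, so the drawing is assembled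
  from three integer configurations of 12 points, each verified by computation. They can be
  glued together because every new edge is cut off from all earlier ones by a side of the
  convex hexagon drawn last.
\<close>

section \<open>Orientation tests for segments\<close>

text \<open>Twice the signed area of the triangle \<open>a b c\<close>; over the reals it is
  positive iff \<open>c\<close> lies left of the directed line from \<open>a\<close> to
  \<open>b\<close>. The ring is left open because values are computed over the integers and
  transferred by \<open>ipt\<close>.\<close>

definition orient :: "'a::comm_ring \<times> 'a \<Rightarrow> 'a \<times> 'a \<Rightarrow> 'a \<times> 'a \<Rightarrow> 'a" where
  "orient a b c = (fst b - fst a) * (snd c - snd a) - (snd b - snd a) * (fst c - fst a)"

definition dotp :: "'a::comm_ring \<times> 'a \<Rightarrow> 'a \<times> 'a \<Rightarrow> 'a" where
  "dotp a b = fst a * fst b + snd a * snd b"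

definition ipt :: "int \<times> int \<Rightarrow> real \<times> real" where
  "ipt q = (of_int (fst q), of_int (snd q))"

lemma orient_ipt: "orient (ipt a) (ipt b) (ipt c) = of_int (orient a b c)"
  by (simp add: orient_def ipt_def)

lemma dotp_diff_ipt:
  "dotp (ipt a - ipt b) (ipt c - ipt d) = of_int (dotp (a - b) (c - d))"
  by (simp add: dotp_def ipt_def)

lemma inj_ipt: "ipt a = ipt b \<longleftrightarrow> a = b"
  by (auto simp: ipt_def prod_eq_iff)

lemma orient_scaleR:
  fixes a b x :: "real \<times> real"
  shows "orient (c *\<^sub>R a) (c *\<^sub>R b) (c *\<^sub>R x) = c\<^sup>2 * orient a b x"
  by (simp add: orient_def algebra_simps power2_eq_square)

lemma orient_convex:
  fixes a b c d :: "real \<times> real"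
  shows "orient a b ((1 - u) *\<^sub>R c + u *\<^sub>R d) = (1 - u) * orient a b c + u * orient a b d"
  by (simp add: orient_def algebra_simps)

lemma orthogonal_dotp: "orthogonal x y \<longleftrightarrow> dotp x y = 0"
  for x y :: "real \<times> real"
  by (simp add: orthogonal_def dotp_def inner_prod_def)

text \<open>At parameter \<open>u\<close>, \<open>x - a\<close> is \<open>u\<close> times
  \<open>b - a\<close>, and \<open>x - b\<close> is \<open>-(1 - u)\<close> times it. The
  contrapositive shows by integer arithmetic that a vertex is off an edge.\<close>

lemma closed_segment_orient_dotp:
  fixes a b x :: "real \<times> real"
  assumes "x \<in> closed_segment a b"
  shows "orient a b x = 0" "dotp (x - a) (x - b) \<le> 0"
proof -
  obtain u where u: "0 \<le> u" "u \<le> 1" "x = (1 - u) *\<^sub>R a + u *\<^sub>R b"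
    using assms by (auto simp: in_segment)
  show "orient a b x = 0"
    unfolding u(3) by (simp add: orient_def algebra_simps)
  have "dotp (x - a) (x - b) = - (u * (1 - u) * dotp (b - a) (b - a))"
    unfolding u(3) by (simp add: dotp_def algebra_simps)
  moreover have "0 \<le> dotp (b - a) (b - a)"
    by (simp add: dotp_def)
  ultimately show "dotp (x - a) (x - b) \<le> 0"
    using u by simp
qed

text \<open>\<open>orient a b\<close> is affine in its third argument, so its value at
  \<open>x\<close> averages, with positive weights, two nonnegative numbers that are not both
  zero.\<close>

lemma orient_open_segment_pos:
  fixes a b c d x :: "real \<times> real"
  assumes "x \<in> open_segment c d" "0 \<le> orient a b c" "0 \<le> orient a b d"
    "orient a b c \<noteq> 0 \<or> orient a b d \<noteq> 0"
  shows "0 < orient a b x"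
proof -
  obtain u where u: "0 < u" "u < 1" "x = (1 - u) *\<^sub>R c + u *\<^sub>R d"
    using assms(1) by (auto simp: in_segment)
  have "0 < (1 - u) * orient a b c \<or> 0 < u * orient a b d"
    using assms u by (auto simp: less_le)
  moreover have "0 \<le> (1 - u) * orient a b c" "0 \<le> u * orient a b d"
    using assms u by auto
  ultimately show ?thesis
    unfolding u(3) orient_convex by linarith
qed

lemma orient_swap: "orient b a x = - orient a b x"
  by (simp add: orient_def algebra_simps)

lemma orient_open_segment_neg:
  fixes a b c d x :: "real \<times> real"
  assumes "x \<in> open_segment c d" "orient a b c \<le> 0" "orient a b d \<le> 0"
    "orient a b c \<noteq> 0 \<or> orient a b d \<noteq> 0"
  shows "orient a b x < 0"
  using orient_open_segment_pos[of x c d b a] assms by (simp add: orient_swap[of b a])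

text \<open>One of the two values may vanish, so that noncollinear edges with a common endpoint also
  pass as noncrossing.\<close>

definition one_sided :: "'a::linordered_idom \<times> 'a \<Rightarrow> 'a \<times> 'a \<Rightarrow> 'a \<times> 'a \<Rightarrow> 'a \<times> 'a \<Rightarrow> bool" where
  "one_sided a b c d \<longleftrightarrow> orient a b c * orient a b d \<ge> 0 \<and> (orient a b c \<noteq> 0 \<or> orient a b d \<noteq> 0)"

lemma one_sided_ipt: "one_sided (ipt a) (ipt b) (ipt c) (ipt d) \<longleftrightarrow> one_sided a b c d"
  unfolding one_sided_def orient_ipt by (simp flip: of_int_mult)

lemma one_sided_disjoint:
  fixes a b c d :: "real \<times> real"
  assumes "one_sided a b c d"
  shows "open_segment a b \<inter> open_segment c d = {}"
proof -
  have "orient a b x \<noteq> 0" if "x \<in> open_segment c d" for x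
    using assms orient_open_segment_pos[OF that, of a b] orient_open_segment_neg[OF that, of a b]
    unfolding one_sided_def zero_le_mult_iff by fastforce
  moreover have "orient a b x = 0" if "x \<in> open_segment a b" for x
    using that closed_segment_orient_dotp(1) by (auto simp: open_segment_def)
  ultimately show ?thesis by blast
qed

section \<open>Integer certificates for drawings\<close>

text \<open>The bound \<open>a < b\<close> gives each edge a single representation, and
  \<open>odd (a + b)\<close> makes index parity a proper 2-colouring. Two distinct edges pass if
  they are perpendicular, whether or not they meet, or if the line through one shows that they do
  not cross.\<close>

definition rac_check :: "(int \<times> int) list \<Rightarrow> (nat \<times> nat) list \<Rightarrow> bool" where
  "rac_check ps es \<longleftrightarrow> distinct ps \<and> distinct es \<and>
     (\<forall>(a, b)\<in>set es. a < b \<and> b < length ps \<and> odd (a + b) \<and>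
        (\<forall>c\<in>set [0..<length ps]. c = a \<or> c = b \<or> orient (ps ! a) (ps ! b) (ps ! c) \<noteq> 0 \<or>
           dotp (ps ! c - ps ! a) (ps ! c - ps ! b) > 0) \<and>
        (\<forall>(c, d)\<in>set es. (a = c \<and> b = d) \<or>
           dotp (ps ! b - ps ! a) (ps ! d - ps ! c) = 0 \<or>
           one_sided (ps ! a) (ps ! b) (ps ! c) (ps ! d) \<or>
           one_sided (ps ! c) (ps ! d) (ps ! a) (ps ! b)))"

lemma ball_prod_iff: "(\<forall>(a, b)\<in>S. P a b) \<longleftrightarrow> (\<forall>a b. (a, b) \<in> S \<longrightarrow> P a b)"
  by auto

lemma rac_check_edge:
  assumes "rac_check ps es" "(a, b) \<in> set es"
  shows "a < b" "a < length ps" "b < length ps" "odd (a + b)"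
  using assms unfolding rac_check_def ball_prod_iff by (meson less_trans)+

lemma rac_check_incidence:
  assumes "rac_check ps es" "(a, b) \<in> set es" "c < length ps" "c \<noteq> a" "c \<noteq> b"
  shows "orient (ps ! a) (ps ! b) (ps ! c) \<noteq> 0 \<or> dotp (ps ! c - ps ! a) (ps ! c - ps ! b) > 0"
proof -
  have "c \<in> set [0..<length ps]" using assms(3) by simp
  then show ?thesis
    using assms(1,2,4,5) unfolding rac_check_def ball_prod_iff by meson
qed

lemma rac_check_crossing:
  assumes "rac_check ps es" "(a, b) \<in> set es" "(c, d) \<in> set es" "(a, b) \<noteq> (c, d)"
  shows "dotp (ps ! b - ps ! a) (ps ! d - ps ! c) = 0 \<or>
    one_sided (ps ! a) (ps ! b) (ps ! c) (ps ! d) \<or> one_sided (ps ! c) (ps ! d) (ps ! a) (ps ! b)"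
proof -
  have "\<not> (a = c \<and> b = d)" using assms(4) by simp
  then show ?thesis
    using assms(1-3) unfolding rac_check_def ball_prod_iff by meson
qed

section \<open>The three configurations of 12 points\<close>

definition shifted_edges :: "nat \<Rightarrow> (nat \<times> nat) list \<Rightarrow> nat set set" where
  "shifted_edges m es = (\<lambda>(a, b). {m + a, m + b}) ` set es"

text \<open>
  For consecutive vertices $v, w$ of a hexagon, the segments from $v$ to $4w$ and from $w$ to $4v$
  are perpendicular if and only if $4 (|v|^2 + |w|^2) = 17 (v \cdot w)$; \<open>hexagon\<close> is an integer
  solution for all six sides. Here \<open>core\<close> is drawn inside 44 times \<open>hexagon\<close>.
\<close>

definition core :: "(int \<times> int) list" where
  "core = [(248, 40), (99, 77), (-99, 77), (-248, 40), (-165, -187), (165, -187)]"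

definition hexagon :: "(int \<times> int) list" where
  "hexagon = [(21, 1), (6, 10), (-6, 10), (-21, 1), (-12, -20), (12, -20)]"

definition outermost :: "(int \<times> int) list" where
  "outermost = [(116, 32), (15, 31), (-15, 31), (-116, 32), (-75, -107), (75, -107)]"

text \<open>The long diagonals \<open>(1, 4)\<close> and \<open>(2, 5)\<close> have the
  perpendicular directions (-264, -264) and (264, -264).\<close>

definition core_edges :: "(nat \<times> nat) list" where
  "core_edges = [(0, 1), (1, 2), (2, 3), (3, 4), (4, 5), (0, 5), (1, 4), (2, 5)]"

text \<open>Vertices 0 to 5 form the inner and vertices 6 to 11 the outer hexagon.\<close>

definition ring_edges :: "(nat \<times> nat) list" where
  "ring_edges =
    [(6, 7), (7, 8), (8, 9), (9, 10), (10, 11), (6, 11),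
     (0, 7), (1, 8), (2, 9), (3, 10), (4, 11), (5, 6),
     (1, 6), (2, 7), (3, 8), (4, 9), (5, 10), (0, 11)]"

definition scale_points :: "int \<Rightarrow> (int \<times> int) list \<Rightarrow> (int \<times> int) list" where
  "scale_points c = map (\<lambda>(x, y). (c * x, c * y))"

lemma length_points [simp]: "length core = 6" "length hexagon = 6" "length outermost = 6"
    "length (scale_points c ps) = length ps"
  by (simp_all add: core_def hexagon_def outermost_def scale_points_def)

lemma rac_check_base: "rac_check (core @ scale_points 44 hexagon) (core_edges @ ring_edges)"
  by code_simp

text \<open>By homothety this serves every pair of consecutive copies of \<open>hexagon\<close>. The
  sides of the inner copy are absent because they belong to the preceding ring.\<close>

lemma rac_check_ring: "rac_check (hexagon @ scale_points 4 hexagon) ring_edges"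
  by code_simp

text \<open>The extra diagonal \<open>(6, 9)\<close> joins (116, 32) to (-116, 32) and passes above
  the vertices (15, 31) and (-15, 31), hence outside the nonconvex hexagon.\<close>

lemma rac_check_last: "rac_check (hexagon @ outermost) ((6, 9) # ring_edges)"
  by code_simp


section \<open>From certificates to RAC drawings\<close>

text \<open>Scaling by \<open>c\<close> is linear and injective, so it commutes with forming
  segments and intersections and keeps right angles. Every condition thus reduces to integer
  points.\<close>

lemma rac_check_sound:
  assumes chk: "rac_check ps es" and c: "0 < c"
    and p: "\<And>i. i < length ps \<Longrightarrow> p (m + i) = c *\<^sub>R ipt (ps ! i)"
  shows "RAC_drawing ({m..<m + length ps}, shifted_edges m es) p"
proof -
  have edge: "\<exists>a b. (a, b) \<in> set es \<and> a < length ps \<and> b < length ps \<and>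
      (u = m + a \<and> v = m + b \<or> u = m + b \<and> v = m + a)"
    if uv: "{u, v} \<in> shifted_edges m es" for u v
  proof -
    obtain a b where "(a, b) \<in> set es" "{u, v} = {m + a, m + b}"
      using uv by (auto simp: shifted_edges_def)
    then show ?thesis
      using rac_check_edge[OF chk] by (metis doubleton_eq_iff)
  qed
  have injc: "inj ((*\<^sub>R) c :: real \<times> real \<Rightarrow> real \<times> real)"
    using c by (simp add: inj_on_def)
  have inj: "inj_on p {m..<m + length ps}"
  proof (rule inj_onI)
    fix u v assume uv: "u \<in> {m..<m + length ps}" "v \<in> {m..<m + length ps}" "p u = p v"
    then have "ps ! (u - m) = ps ! (v - m)"
      using p[of "u - m"] p[of "v - m"] c by (auto simp: inj_ipt)
    then have "u - m = v - m"
      using uv chk nth_eq_iff_index_eq[of ps "u - m" "v - m"] unfolding rac_check_def by auto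
    then show "u = v" using uv by auto
  qed
  have free: "p (m + i) \<notin> closed_segment (p (m + a)) (p (m + b))"
    if ab: "(a, b) \<in> set es" and i: "i < length ps" "i \<noteq> a" "i \<noteq> b" for a b i
  proof
    assume "p (m + i) \<in> closed_segment (p (m + a)) (p (m + b))"
    moreover have l: "a < length ps" "b < length ps"
      using rac_check_edge[OF chk ab] by auto
    ultimately have "c *\<^sub>R ipt (ps ! i) \<in> (*\<^sub>R) c ` closed_segment (ipt (ps ! a)) (ipt (ps ! b))"
      using p i by (simp add: closed_segment_linear_image)
    then have *: "ipt (ps ! i) \<in> closed_segment (ipt (ps ! a)) (ipt (ps ! b))"
      by (simp only: inj_image_mem_iff[OF injc])
    show False
      using closed_segment_orient_dotp[OF *] rac_check_incidence[OF chk ab i]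
      unfolding orient_ipt dotp_diff_ipt by simp
  qed
  have cross: "orthogonal (p (m + b) - p (m + a)) (p (m + e) - p (m + d))"
    if ab: "(a, b) \<in> set es" and de: "(d, e) \<in> set es" and ne: "(a, b) \<noteq> (d, e)"
      and meet: "open_segment (p (m + a)) (p (m + b)) \<inter> open_segment (p (m + d)) (p (m + e)) \<noteq> {}"
    for a b d e
  proof -
    have l: "a < length ps" "b < length ps" "d < length ps" "e < length ps"
      using rac_check_edge[OF chk ab] rac_check_edge[OF chk de] by auto
    have "open_segment (p (m + a)) (p (m + b)) = (*\<^sub>R) c ` open_segment (ipt (ps ! a)) (ipt (ps ! b))"
      "open_segment (p (m + d)) (p (m + e)) = (*\<^sub>R) c ` open_segment (ipt (ps ! d)) (ipt (ps ! e))"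
      using p l by (simp_all add: open_segment_linear_image[OF _ injc])
    then have "open_segment (ipt (ps ! a)) (ipt (ps ! b)) \<inter> open_segment (ipt (ps ! d)) (ipt (ps ! e)) \<noteq> {}"
      using meet by (simp only: image_Int[OF injc, symmetric] image_is_empty not_False_eq_True)
    \<comment> \<open>Segments that meet fail both separation tests, which leaves only
      perpendicularity.\<close>
    then have "\<not> one_sided (ps ! a) (ps ! b) (ps ! d) (ps ! e)"
      "\<not> one_sided (ps ! d) (ps ! e) (ps ! a) (ps ! b)"
      using one_sided_disjoint one_sided_ipt by (metis Int_commute)+
    then have "dotp (ps ! b - ps ! a) (ps ! e - ps ! d) = 0"
      using rac_check_crossing[OF chk ab de ne] by simp
    then have "orthogonal (ipt (ps ! b) - ipt (ps ! a)) (ipt (ps ! e) - ipt (ps ! d))"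
      by (simp add: orthogonal_dotp dotp_diff_ipt)
    then show ?thesis
      using p l by (simp add: orthogonal_def flip: scaleR_diff_right)
  qed
  have "straight_line_drawing ({m..<m + length ps}, shifted_edges m es) p"
    unfolding straight_line_drawing_def fst_conv snd_conv
  proof (intro conjI inj allI impI)
    fix u v w
    assume h: "{u, v} \<in> shifted_edges m es \<and> w \<in> {m..<m + length ps} - {u, v}"
    then obtain a b where ab: "(a, b) \<in> set es"
        "u = m + a \<and> v = m + b \<or> u = m + b \<and> v = m + a"
      using edge by meson
    obtain i where i: "w = m + i" "i < length ps"
      using h that[of "w - m"] by auto
    show "p w \<notin> closed_segment (p u) (p v)"
      using ab(2) h i free[OF ab(1) i(2)] by (auto simp: closed_segment_commute)
  qed
  moreover have "orthogonal (p v - p u) (p y - p x)"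
    if uv: "{u, v} \<in> shifted_edges m es" and xy: "{x, y} \<in> shifted_edges m es"
      and h: "edges_cross p u v x y" for u v x y
  proof -
    obtain a b where ab: "(a, b) \<in> set es"
        "u = m + a \<and> v = m + b \<or> u = m + b \<and> v = m + a"
      using edge uv by meson
    obtain d e where de: "(d, e) \<in> set es"
        "x = m + d \<and> y = m + e \<or> x = m + e \<and> y = m + d"
      using edge xy by meson
    have "orthogonal (p (m + b) - p (m + a)) (p (m + e) - p (m + d))"
    proof (rule cross[OF ab(1) de(1)])
      show "(a, b) \<noteq> (d, e)"
        using h ab(2) de(2) unfolding edges_cross_def by (auto simp: insert_commute)
      show "open_segment (p (m + a)) (p (m + b)) \<inter> open_segment (p (m + d)) (p (m + e)) \<noteq> {}"
        using h ab(2) de(2) unfolding edges_cross_def by (auto simp: open_segment_commute)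
    qed
    then show ?thesis
      using ab(2) de(2)
      by (auto simp: orthogonal_def inner_diff_left inner_diff_right algebra_simps)
  qed
  ultimately show ?thesis
    unfolding RAC_drawing_def by auto
qed

section \<open>Gluing along a convex hexagon\<close>

text \<open>Edges of \<open>E\<close> lie in \<open>K\<close> by convexity and open edges of
  \<open>F\<close> avoid \<open>K\<close>, so crossings occur only within one of the two drawings.
  Vertices of \<open>W - V\<close> are outside \<open>K\<close> and miss the edges of
  \<open>E\<close>; vertices of \<open>V\<close> are in \<open>K\<close> and could meet an edge of
  \<open>F\<close> only at its ends.\<close>

lemma RAC_drawing_Un:
  assumes R1: "RAC_drawing (V, E) p" and R2: "RAC_drawing (W, F) p"
    and E: "\<And>e. e \<in> E \<Longrightarrow> e \<subseteq> V" and F: "\<And>e. e \<in> F \<Longrightarrow> e \<subseteq> W"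
    and K: "convex K" "p ` V \<subseteq> K" "\<And>v. v \<in> W - V \<Longrightarrow> p v \<notin> K"
    and out: "\<And>u v. {u, v} \<in> F \<Longrightarrow> open_segment (p u) (p v) \<inter> K = {}"
  shows "RAC_drawing (V \<union> W, E \<union> F) p"
proof -
  have S1: "straight_line_drawing (V, E) p" and S2: "straight_line_drawing (W, F) p"
    using R1 R2 by (auto simp: RAC_drawing_def)
  have inj: "inj_on p (V \<union> W)"
  proof -
    have "inj_on p V" "inj_on p (W - V)"
      using S1 S2 by (auto simp: straight_line_drawing_def intro: inj_on_diff)
    \<comment> \<open>The set differences have the shape that \<open>inj_on_Un\<close> produces for
      \<open>V\<close> and \<open>W - V\<close>.\<close>
    moreover have "p ` (V - (W - V)) \<inter> p ` (W - V - V) = {}"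
    proof -
      have "p ` (V - (W - V)) \<subseteq> K" "p ` (W - V - V) \<inter> K = {}"
        using K(2,3) by auto
      then show ?thesis by blast
    qed
    ultimately have "inj_on p (V \<union> (W - V))"
      by (simp only: inj_on_Un)
    then show ?thesis by simp
  qed
  have inK: "closed_segment (p u) (p v) \<subseteq> K" if "{u, v} \<in> E" for u v
    using E[OF that] K(1,2) by (simp add: closed_segment_subset image_subset_iff)
  have "straight_line_drawing (V \<union> W, E \<union> F) p"
    unfolding straight_line_drawing_def fst_conv snd_conv
  proof (intro conjI inj allI impI)
    fix u v w assume h: "{u, v} \<in> E \<union> F \<and> w \<in> V \<union> W - {u, v}"
    show "p w \<notin> closed_segment (p u) (p v)"
    proof (cases "{u, v} \<in> E")
      case True
      show ?thesis
      proof (cases "w \<in> V")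
        case True
        then show ?thesis
          using S1 h \<open>{u, v} \<in> E\<close> by (auto simp: straight_line_drawing_def)
      next
        case False
        then show ?thesis using h K(3)[of w] inK[OF True] by blast
      qed
    next
      case False
      then have uv: "{u, v} \<in> F" using h by blast
      show ?thesis
      proof (cases "w \<in> W")
        case True
        then show ?thesis
          using S2 h uv by (auto simp: straight_line_drawing_def)
      next
        case False
        then have "p w \<in> K" using h K(2) by auto
        then have "p w \<notin> open_segment (p u) (p v)" using out[OF uv] by blast
        moreover have "p w \<noteq> p u" "p w \<noteq> p v"
          using inj h F[OF uv] by (auto dest: inj_onD)
        ultimately show ?thesis by (simp add: open_segment_def)
      qed
    qed
  qed
  moreover have "orthogonal (p v - p u) (p y - p x)"
    if "{u, v} \<in> E \<union> F" "{x, y} \<in> E \<union> F" "edges_cross p u v x y" for u v x y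
  proof -
    have "\<not> edges_cross p u v x y" if "{u, v} \<in> E" "{x, y} \<in> F" for u v x y
      using inK[OF that(1)] out[OF that(2)] segment_open_subset_closed[of "p u" "p v"]
      unfolding edges_cross_def by blast
    moreover have "edges_cross p x y u v"
      using that(3) unfolding edges_cross_def by blast
    ultimately show ?thesis
      using that R1 R2 unfolding RAC_drawing_def by auto
  qed
  ultimately show ?thesis
    unfolding RAC_drawing_def by auto
qed

text \<open>For \<open>0 < c\<close> this is the closed scaled hexagon, since \<open>hexagon\<close>
  is convex and listed counterclockwise. As an intersection of half-planes it is visibly convex, and
  one negative orientation excludes a point.\<close>

definition hexagon_region :: "real \<Rightarrow> (real \<times> real) set" where
  "hexagon_region c =
    {x. \<forall>i<6. 0 \<le> orient (c *\<^sub>R ipt (hexagon ! i)) (c *\<^sub>R ipt (hexagon ! (Suc i mod 6))) x}"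

lemma convex_hexagon_region: "convex (hexagon_region c)"
  unfolding convex_alt hexagon_region_def by (auto simp: orient_convex)

text \<open>Both ends of an edge are tested against the same side line; end \<open>a\<close> may lie
  on it, being possibly a vertex of the inner hexagon. The bound \<open>6 \<le> b\<close> gives
  every edge a new vertex, so that new edges differ from old ones.\<close>

definition outside_check :: "(int \<times> int) list \<Rightarrow> (nat \<times> nat) list \<Rightarrow> bool" where
  "outside_check qs es \<longleftrightarrow> (let ps = hexagon @ qs in length qs = 6 \<and>
     (\<forall>j\<in>set [6..<12]. \<exists>i\<in>set [0..<6].
        orient (hexagon ! i) (hexagon ! (Suc i mod 6)) (ps ! j) < 0) \<and>
     (\<forall>(a, b)\<in>set es. 6 \<le> b \<and> (\<exists>i\<in>set [0..<6].
        orient (hexagon ! i) (hexagon ! (Suc i mod 6)) (ps ! a) \<le> 0 \<and>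
        orient (hexagon ! i) (hexagon ! (Suc i mod 6)) (ps ! b) < 0)))"

lemma outside_check_vertex:
  assumes "outside_check qs es" "6 \<le> j" "j < 12"
  shows "\<exists>i<6. orient (hexagon ! i) (hexagon ! (Suc i mod 6)) ((hexagon @ qs) ! j) < 0"
proof -
  have "j \<in> set [6..<12]" using assms by (simp only: set_upt atLeastLessThan_iff)
  then have "\<exists>i\<in>set [0..<6]. orient (hexagon ! i) (hexagon ! (Suc i mod 6)) ((hexagon @ qs) ! j) < 0"
    using assms(1) unfolding outside_check_def Let_def by meson
  then show ?thesis by (metis atLeastLessThan_iff set_upt)
qed

lemma outside_check_edge:
  assumes "outside_check qs es" "(a, b) \<in> set es"
  shows "6 \<le> b" "\<exists>i<6. orient (hexagon ! i) (hexagon ! (Suc i mod 6)) ((hexagon @ qs) ! a) \<le> 0 \<and>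
    orient (hexagon ! i) (hexagon ! (Suc i mod 6)) ((hexagon @ qs) ! b) < 0"
proof -
  have *: "6 \<le> b \<and> (\<exists>i\<in>set [0..<6].
      orient (hexagon ! i) (hexagon ! (Suc i mod 6)) ((hexagon @ qs) ! a) \<le> 0 \<and>
      orient (hexagon ! i) (hexagon ! (Suc i mod 6)) ((hexagon @ qs) ! b) < 0)"
    using assms unfolding outside_check_def Let_def ball_prod_iff by meson
  then show "6 \<le> b" ..
  from * show "\<exists>i<6. orient (hexagon ! i) (hexagon ! (Suc i mod 6)) ((hexagon @ qs) ! a) \<le> 0 \<and>
      orient (hexagon ! i) (hexagon ! (Suc i mod 6)) ((hexagon @ qs) ! b) < 0"
    by (metis atLeastLessThan_iff set_upt)
qed

lemma outside_check_ring: "outside_check (scale_points 4 hexagon) ring_edges"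
  by code_simp

lemma outside_check_last: "outside_check outermost ((6, 9) # ring_edges)"
  by code_simp

lemma shifted_edges_subset:
  assumes "rac_check ps es" "e \<in> shifted_edges m es"
  shows "e \<subseteq> {m..<m + length ps}" "card e = 2"
proof -
  obtain a b where "(a, b) \<in> set es" "e = {m + a, m + b}"
    using assms(2) by (auto simp: shifted_edges_def)
  then show "e \<subseteq> {m..<m + length ps}" "card e = 2"
    using rac_check_edge[OF assms(1), of a b] by auto
qed

text \<open>This is \<open>RAC_drawing_Un\<close> with \<open>K\<close> the hexagon drawn last,
  whose six vertices, from index \<open>m\<close> on, are shared by both drawings.\<close>

lemma RAC_drawing_attach:
  assumes R: "RAC_drawing ({..<m + 6}, E) p" and E: "\<And>e. e \<in> E \<Longrightarrow> e \<subseteq> {..<m + 6}"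
    and K: "p ` {..<m + 6} \<subseteq> hexagon_region c" and c: "0 < c"
    and chk: "rac_check (hexagon @ qs) es" "outside_check qs es"
    and p: "\<And>i. i < 12 \<Longrightarrow> p (m + i) = c *\<^sub>R ipt ((hexagon @ qs) ! i)"
  shows "RAC_drawing ({..<m + 12}, E \<union> shifted_edges m es) p"
proof -
  have len: "length (hexagon @ qs) = 12"
    using chk(2) by (simp add: outside_check_def Let_def)
  have orient_p: "orient (c *\<^sub>R ipt (hexagon ! i)) (c *\<^sub>R ipt (hexagon ! (Suc i mod 6))) (p (m + j)) =
      c\<^sup>2 * of_int (orient (hexagon ! i) (hexagon ! (Suc i mod 6)) ((hexagon @ qs) ! j))"
    if "j < 12" for i j
    using p[OF that] by (simp add: orient_scaleR orient_ipt)
  have "RAC_drawing ({..<m + 6} \<union> {m..<m + length (hexagon @ qs)}, E \<union> shifted_edges m es) p"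
  proof (rule RAC_drawing_Un[OF R rac_check_sound[OF chk(1) c] E])
    show "p (m + i) = c *\<^sub>R ipt ((hexagon @ qs) ! i)" if "i < length (hexagon @ qs)" for i
      using p that len by simp
    show "convex (hexagon_region c)" by (rule convex_hexagon_region)
    show "p v \<notin> hexagon_region c" if v: "v \<in> {m..<m + length (hexagon @ qs)} - {..<m + 6}" for v
    proof -
      obtain j where j: "v = m + j" "6 \<le> j" "j < 12"
        using that[of "v - m"] v len by auto
      then obtain i where "i < 6"
        "orient (hexagon ! i) (hexagon ! (Suc i mod 6)) ((hexagon @ qs) ! j) < 0"
        using outside_check_vertex[OF chk(2)] by blast
      then show ?thesis
        using c j(3) unfolding hexagon_region_def
        by (auto simp: j(1) orient_p mult_less_0_iff not_le intro!: exI[of _ i])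
    qed
    show "open_segment (p u) (p v) \<inter> hexagon_region c = {}" if uv: "{u, v} \<in> shifted_edges m es" for u v
    proof -
      obtain a b where ab: "(a, b) \<in> set es" "{u, v} = {m + a, m + b}"
        using uv by (auto simp: shifted_edges_def)
      then have l: "a < 12" "b < 12"
        using rac_check_edge[OF chk(1)] len by metis+
      obtain i where i: "i < 6"
        "orient (hexagon ! i) (hexagon ! (Suc i mod 6)) ((hexagon @ qs) ! a) \<le> 0"
        "orient (hexagon ! i) (hexagon ! (Suc i mod 6)) ((hexagon @ qs) ! b) < 0"
        using outside_check_edge[OF chk(2) ab(1)] by blast
      \<comment> \<open>A single side line has the whole open edge strictly on its outer
        side.\<close>
      have "orient (c *\<^sub>R ipt (hexagon ! i)) (c *\<^sub>R ipt (hexagon ! (Suc i mod 6))) x < 0"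
        if "x \<in> open_segment (p (m + a)) (p (m + b))" for x
        by (rule orient_open_segment_neg[OF that]) (use i c l in \<open>auto simp: orient_p mult_le_0_iff\<close>)
      then have "open_segment (p (m + a)) (p (m + b)) \<inter> hexagon_region c = {}"
        using i(1) unfolding hexagon_region_def by (fastforce simp: not_le)
      then show ?thesis
        using ab(2) by (auto simp: doubleton_eq_iff open_segment_commute)
    qed
  qed (use K shifted_edges_subset[OF chk(1)] in auto)
  moreover have "{..<m + 6} \<union> {m..<m + length (hexagon @ qs)} = {..<m + 12}"
    using len by auto
  ultimately show ?thesis by simp
qed

section \<open>Nested homothetic hexagons\<close>

text \<open>Stage \<open>k\<close> consists of the core and \<open>k + 1\<close> copies of
  \<open>hexagon\<close>; the last copy starts at index \<open>6 * k + 6\<close>.\<close>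

fun inner_edges :: "nat \<Rightarrow> nat set set" where
  "inner_edges 0 = shifted_edges 0 (core_edges @ ring_edges)"
| "inner_edges (Suc k) = inner_edges k \<union> shifted_edges (6 * k + 6) ring_edges"

text \<open>The layer of \<open>v\<close> is \<open>v div 6\<close>, with the core as layer 0. One
  map serves all stages, so adding a layer moves no vertex.\<close>

definition inner_pos :: "nat \<Rightarrow> real \<times> real" where
  "inner_pos v = (if v < 6 then ipt (core ! v)
     else (44 * 4 ^ (v div 6 - 1)) *\<^sub>R ipt (hexagon ! (v mod 6)))"

lemma ipt_scale_points:
  "i < length ps \<Longrightarrow> ipt (scale_points c ps ! i) = of_int c *\<^sub>R ipt (ps ! i)"
  by (simp add: scale_points_def ipt_def case_prod_beta)

lemma inner_pos_layer:
  "i < 6 \<Longrightarrow> inner_pos (6 * k + 6 + i) = (44 * 4 ^ k) *\<^sub>R ipt (hexagon ! i)"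
proof -
  assume i: "i < 6"
  have "6 * k + 6 + i = i + 6 * Suc k" by simp
  then have "(6 * k + 6 + i) div 6 = Suc k" "(6 * k + 6 + i) mod 6 = i"
    using i by (simp_all only: div_mult_self2 mod_mult_self2) simp_all
  then show ?thesis by (simp add: inner_pos_def)
qed

lemma inner_pos_base:
  assumes "i < 12" shows "inner_pos i = ipt ((core @ scale_points 44 hexagon) ! i)"
proof (cases "i < 6")
  case False
  then show ?thesis
    using inner_pos_layer[of "i - 6" 0] assms by (simp add: nth_append ipt_scale_points)
qed (simp add: inner_pos_def nth_append)

text \<open>The origin lies in each of the six half-planes, so enlargement pushes their boundary
  lines outwards.\<close>

lemma hexagon_region_mono:
  assumes "0 < c"
  shows "hexagon_region c \<subseteq> hexagon_region (4 * c)"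
proof -
  have "list_all (\<lambda>i. orient 0 (hexagon ! i) (hexagon ! (Suc i mod 6)) \<ge> 0) [0..<6]"
    by code_simp
  then have *: "0 \<le> orient 0 (ipt (hexagon ! i)) (ipt (hexagon ! (Suc i mod 6)))" if "i < 6" for i
    using that orient_ipt[of 0] by (simp add: list_all_iff ipt_def zero_prod_def)
  \<comment> \<open>With determinants, \<open>orient (s a) (s b) x\<close> is
    \<open>s^2 det(a, b) + s det(b - a, x)\<close>. Comparing \<open>s = 4 c\<close> with 4 times
    the value at \<open>s = c\<close> leaves the coefficient 16 - 4 = 12.\<close>
  have "orient ((4 * c) *\<^sub>R a) ((4 * c) *\<^sub>R b) x =
      4 * orient (c *\<^sub>R a) (c *\<^sub>R b) x + 12 * c\<^sup>2 * orient 0 a b" for a b x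
    by (simp add: orient_def algebra_simps power2_eq_square)
  then show ?thesis
    using * unfolding hexagon_region_def by auto
qed

lemma hexagon_in_region:
  assumes "j < 6"
  shows "c *\<^sub>R ipt (hexagon ! j) \<in> hexagon_region c"
proof -
  have "list_all (\<lambda>i. list_all (\<lambda>j. orient (hexagon ! i) (hexagon ! (Suc i mod 6)) (hexagon ! j) \<ge> 0) [0..<6]) [0..<6]"
    by code_simp
  then show ?thesis
    using assms by (auto simp: list_all_iff hexagon_region_def orient_scaleR orient_ipt)
qed

lemma core_in_region:
  assumes "j < 6"
  shows "ipt (core ! j) \<in> hexagon_region 44"
proof -
  let ?h = "scale_points 44 hexagon"
  have "list_all (\<lambda>i. list_all (\<lambda>j. orient (?h ! i) (?h ! (Suc i mod 6)) (core ! j) \<ge> 0) [0..<6]) [0..<6]"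
    by code_simp
  then have "0 \<le> orient (ipt (?h ! i)) (ipt (?h ! (Suc i mod 6))) (ipt (core ! j))" if "i < 6" for i
    using assms that by (auto simp: list_all_iff orient_ipt)
  then show ?thesis
    by (simp add: hexagon_region_def ipt_scale_points)
qed

lemma inner_edges_subset: "e \<in> inner_edges k \<Longrightarrow> e \<subseteq> {..<6 * k + 12} \<and> card e = 2"
proof (induction k)
  case 0
  then show ?case
    using shifted_edges_subset[OF rac_check_base, of e 0] by auto
next
  case (Suc k)
  then show ?case
    using shifted_edges_subset[OF rac_check_ring, of e "6 * k + 6"] by (fastforce simp: subset_iff)
qed

text \<open>The newest hexagon consists of corners of its own region, and earlier layers lie in
  smaller regions.\<close>

lemma inner_pos_in_region:
  "v < 6 * k + 12 \<Longrightarrow> inner_pos v \<in> hexagon_region (44 * 4 ^ k)"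
proof (induction k)
  case 0
  then show ?case
    using core_in_region[of v] hexagon_in_region[of "v - 6" 44] inner_pos_layer[of "v - 6" 0]
    by (cases "v < 6") (auto simp: inner_pos_def)
next
  case (Suc k)
  show ?case
  proof (cases "v < 6 * k + 12")
    case True
    then show ?thesis
      using Suc.IH hexagon_region_mono[of "44 * 4 ^ k"] by (auto simp: mult.left_commute)
  next
    case False
    then show ?thesis
      using Suc.prems inner_pos_layer[of "v - (6 * k + 12)" "Suc k"]
        hexagon_in_region[of "v - (6 * k + 12)" "44 * 4 ^ Suc k"] by simp
  qed
qed

lemma RAC_drawing_inner: "RAC_drawing ({..<6 * k + 12}, inner_edges k) inner_pos"
proof (induction k)
  case 0
  have "RAC_drawing ({0..<0 + length (core @ scale_points 44 hexagon)}, inner_edges 0) inner_pos"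
    unfolding inner_edges.simps
    by (rule rac_check_sound[OF rac_check_base, of 1]) (simp_all add: inner_pos_base)
  then show ?case by (simp add: atLeast0LessThan)
next
  case (Suc k)
  have "RAC_drawing ({..<(6 * k + 6) + 12}, inner_edges k \<union> shifted_edges (6 * k + 6) ring_edges) inner_pos"
  proof (rule RAC_drawing_attach[OF _ _ _ _ rac_check_ring outside_check_ring])
    show "inner_pos (6 * k + 6 + i) = (44 * 4 ^ k) *\<^sub>R ipt ((hexagon @ scale_points 4 hexagon) ! i)"
      if "i < 12" for i
    proof (cases "i < 6")
      case True
      then show ?thesis using inner_pos_layer[of i k] by (simp add: nth_append)
    next
      case False
      \<comment> \<open>Indices 6 to 11 of the configuration form the next layer, whose scale is 4
        times larger.\<close>
      then have "6 * k + 6 + i = 6 * Suc k + 6 + (i - 6)" by simp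
      then show ?thesis
        using that False inner_pos_layer[of "i - 6" "Suc k"]
        by (simp only:) (simp add: nth_append ipt_scale_points mult.commute)
    qed
  qed (use Suc inner_edges_subset[of _ k] inner_pos_in_region[of _ k] in \<open>auto simp: add.assoc\<close>)
  then show ?case by (simp add: add.commute)
qed

section \<open>The nonconvex outermost hexagon\<close>

text \<open>Allows \<open>inner_pos\<close> to be replaced by a map that places the outermost
  hexagon beyond the vertices drawn so far.\<close>

lemma RAC_drawing_cong:
  assumes "RAC_drawing (V, E) p" "\<And>e. e \<in> E \<Longrightarrow> e \<subseteq> V" "\<And>v. v \<in> V \<Longrightarrow> q v = p v"
  shows "RAC_drawing (V, E) q"
proof -
  have "q u = p u \<and> q v = p v" if "{u, v} \<in> E" for u v
    using assms(2)[OF that] assms(3) by auto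
  moreover have "inj_on q V = inj_on p V"
    using assms(3) by (rule inj_on_cong)
  ultimately show ?thesis
    using assms(1,3) unfolding RAC_drawing_def straight_line_drawing_def edges_cross_def
      fst_conv snd_conv by (metis DiffD1)
qed

text \<open>There are \<open>k + 3\<close> hexagons: the core, \<open>k + 1\<close> copies of
  \<open>hexagon\<close> and the outermost one.\<close>

definition rac_graph :: "nat \<Rightarrow> nat graph" where
  "rac_graph k = ({..<6 * k + 18}, inner_edges k \<union> shifted_edges (6 * k + 6) ((6, 9) # ring_edges))"

lemma RAC_graph_rac_graph: "RAC_graph (rac_graph k)"
proof -
  define q where "q v = (if v < 6 * k + 12 then inner_pos v
    else (44 * 4 ^ k) *\<^sub>R ipt (outermost ! (v - (6 * k + 12))))" for v
  have "RAC_drawing ({..<(6 * k + 6) + 12},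
      inner_edges k \<union> shifted_edges (6 * k + 6) ((6, 9) # ring_edges)) q"
  proof (rule RAC_drawing_attach[OF _ _ _ _ rac_check_last outside_check_last])
    show "RAC_drawing ({..<6 * k + 6 + 6}, inner_edges k) q"
      using RAC_drawing_cong[OF RAC_drawing_inner[of k], of q] inner_edges_subset
      by (simp add: q_def add.assoc)
    show "q (6 * k + 6 + i) = (44 * 4 ^ k) *\<^sub>R ipt ((hexagon @ outermost) ! i)" if "i < 12" for i
      using that inner_pos_layer[of i k] by (auto simp: q_def nth_append)
  qed (use inner_edges_subset[of _ k] inner_pos_in_region[of _ k] in \<open>auto simp: add.assoc q_def\<close>)
  then have "RAC_drawing (rac_graph k) q"
    by (simp add: rac_graph_def add.commute)
  moreover have "simple_graph (rac_graph k)"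
    using inner_edges_subset[of _ k] shifted_edges_subset[OF rac_check_last, of _ "6 * k + 6"]
    by (fastforce simp: simple_graph_def rac_graph_def)
  ultimately show ?thesis
    unfolding RAC_graph_def by blast
qed

section \<open>Bipartiteness by index parity\<close>

lemma shifted_edges_parity:
  assumes "rac_check ps es" "even m" "e \<in> shifted_edges m es"
  shows "\<exists>a b. even a \<and> odd b \<and> e = {a, b}"
proof -
  obtain a b where "(a, b) \<in> set es" and ab: "e = {m + a, m + b}"
    using assms(3) by (auto simp: shifted_edges_def)
  then have "odd (a + b)"
    using rac_check_edge[OF assms(1)] by blast
  then show ?thesis
    using assms(2) ab by (metis even_add insert_commute)
qed

lemma bipartite_rac_graph: "bipartite (rac_graph k)"
proof -
  have inner: "\<exists>a b. even a \<and> odd b \<and> e = {a, b}" if "e \<in> inner_edges k" for e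
    using that
  proof (induction k)
    case 0
    then show ?case using shifted_edges_parity[OF rac_check_base, of 0 e] by simp
  next
    case (Suc k)
    then show ?case using shifted_edges_parity[OF rac_check_ring, of "6 * k + 6" e] by auto
  qed
  have par: "\<exists>a b. even a \<and> odd b \<and> e = {a, b}" if "e \<in> edges (rac_graph k)" for e
    using that inner shifted_edges_parity[OF rac_check_last, of "6 * k + 6"]
    by (auto simp: rac_graph_def)
  have sub: "e \<subseteq> verts (rac_graph k)" if "e \<in> edges (rac_graph k)" for e
    using RAC_graph_rac_graph that unfolding RAC_graph_def simple_graph_def by blast
  show ?thesis
    unfolding bipartite_def
  proof (intro exI conjI ballI)
    fix e assume "e \<in> edges (rac_graph k)"
    then show "\<exists>a\<in>{v \<in> verts (rac_graph k). even v}. \<exists>b\<in>{v \<in> verts (rac_graph k). odd v}. e = {a, b}"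
      using par[of e] sub[of e] by auto
  qed auto
qed

section \<open>Edge counts and the infinite family\<close>

text \<open>Since \<open>a < b\<close> in every pair, distinct pairs give distinct unordered
  edges.\<close>

lemma card_shifted_edges:
  assumes "rac_check ps es"
  shows "card (shifted_edges m es) = length es"
proof -
  have "inj_on (\<lambda>(a, b). {m + a, m + b}) (set es)"
  proof (rule inj_onI, clarify)
    fix a b c d assume "(a, b) \<in> set es" "(c, d) \<in> set es" "{m + a, m + b} = {m + c, m + d}"
    moreover from this have "a < b" "c < d"
      using rac_check_edge[OF assms] by blast+
    ultimately show "a = c \<and> b = d"
      by (auto simp: doubleton_eq_iff)
  qed
  then show ?thesis
    using assms by (simp add: shifted_edges_def card_image rac_check_def distinct_card)
qed

text \<open>Every new edge contains some \<open>m + b\<close> with \<open>6 \<le> b\<close>, a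
  vertex of no old edge.\<close>

lemma card_attach:
  assumes "finite E" "\<And>e. e \<in> E \<Longrightarrow> e \<subseteq> {..<m + 6}"
    "rac_check ps es" "outside_check qs es"
  shows "card (E \<union> shifted_edges m es) = card E + length es"
proof -
  have "e \<notin> E" if e: "e \<in> shifted_edges m es" for e
  proof -
    obtain a b where "(a, b) \<in> set es" "e = {m + a, m + b}"
      using e by (auto simp: shifted_edges_def)
    then show ?thesis
      using outside_check_edge(1)[OF assms(4)] assms(2)[of e] by fastforce
  qed
  then have "E \<inter> shifted_edges m es = {}" by blast
  then show ?thesis
    using assms(1) card_shifted_edges[OF assms(3)]
    by (simp add: card_Un_disjoint shifted_edges_def)
qed

lemma finite_inner_edges: "finite (inner_edges k)"
  by (induction k) (auto simp: shifted_edges_def)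

text \<open>The base has 8 + 18 = 26 edges, and each further ring adds 18.\<close>

lemma card_inner_edges: "card (inner_edges k) = 18 * k + 26"
proof (induction k)
  case 0
  then show ?case
    using card_shifted_edges[OF rac_check_base, of 0] by (simp add: core_edges_def ring_edges_def)
next
  case (Suc k)
  have "card (inner_edges (Suc k)) = card (inner_edges k) + length ring_edges"
    unfolding inner_edges.simps
    using inner_edges_subset[of _ k]
    by (intro card_attach[OF finite_inner_edges _ rac_check_ring outside_check_ring])
      (auto simp: add.assoc)
  then show ?case using Suc by (simp add: ring_edges_def)
qed

text \<open>The last ring and the outer diagonal add 19 edges to the \<open>18 * k + 26\<close>
  inner ones.\<close>

lemma card_edges_rac_graph: "card (edges (rac_graph k)) = 18 * k + 45"
proof -
  have "card (edges (rac_graph k)) = card (inner_edges k) + length ((6::nat, 9::nat) # ring_edges)"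
    unfolding rac_graph_def snd_conv
    using inner_edges_subset[of _ k]
    by (intro card_attach[OF finite_inner_edges _ rac_check_last outside_check_last])
      (auto simp: add.assoc)
  then show ?thesis by (simp add: card_inner_edges ring_edges_def)
qed

theorem theorem5:
  "\<exists>\<G> :: nat graph set. infinite \<G> \<and>
     pairwise (\<lambda>G H. \<not> isomorphic_graphs G H) \<G> \<and>
     (\<forall>G\<in>\<G>. RAC_graph G \<and> bipartite G \<and>
        int (card (edges G)) = 3 * int (card (verts G)) - 9)"
proof (intro exI conjI)
  have card_verts: "card (verts (rac_graph k)) = 6 * k + 18" for k
    by (simp add: rac_graph_def)
  then have "inj rac_graph"
    by (metis add_right_cancel injI mult_cancel1 zero_neq_numeral)
  then show "infinite (range rac_graph)"
    by (simp add: finite_image_iff)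
  \<comment> \<open>An isomorphism would equate the vertex counts \<open>6 * k + 18\<close>, which
    determine \<open>k\<close>.\<close>
  show "pairwise (\<lambda>G H. \<not> isomorphic_graphs G H) (range rac_graph)"
    unfolding pairwise_def isomorphic_graphs_def
    by (auto dest!: bij_betw_same_card simp: card_verts)
  show "\<forall>G\<in>range rac_graph. RAC_graph G \<and> bipartite G \<and>
      int (card (edges G)) = 3 * int (card (verts G)) - 9"
    by (auto simp: RAC_graph_rac_graph bipartite_rac_graph card_verts card_edges_rac_graph)
qed

end
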